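(* Let $n\ge 2$ and let $0\le \epsilon<1/2$. Let $\mathcal{A}$ be any quantum query (decision tree) algorithm that, for every permutation $\sigma$ of $\{0,1,\dots,n-1\}$, given oracle access to the comparison matrix $M_\sigma$, outputs $\sigma$ with probability at least $1-\epsilon$. Then the number $T$ of comparisons (oracle queries) made by $\mathcal{A}$ satisfies $$T\ \ge\ \frac{1-2\sqrt{\epsilon(1-\epsilon)}}{2\pi}\,\bigl(nH_{n-1}-n+1\bigr),$$ where $H_m=\sum_{i=1}^m 1/i$. In particular, for every constant $\epsilon<1/2$, $T=\Omega(n\log n)$.
   Context: Sorting $n$ numbers by comparisons is modeled as follows. The numbers $x_0,\dots,x_{n-1}$ are given by a permutation $\sigma$ of $\{0,\dots,n-1\}$ via $x_i=\sigma(i)$, and the input is the comparison matrix $M_\sigma\in\{0,1\}^{n\times n}$ with $(M_\sigma)_{i,j}=1$ if $\sigma(i)\le\sigma(j)$ and $0$ otherwise. A quantum query algorithm works in the Hilbert space $H$ spanned by orthonormal basis vectors $|i,j,b,c\rangle$ with $0\le i,j\le n-1$, $b\in\{0,1\}$, $c\in\{0,1\}^w$ for some fixed $w\ge0$. The oracle (comparison) gate for input $\sigma$ is the unitary $O_\sigma|i,j,b,c\rangle=|i,j,b\oplus(M_\sigma)_{i,j},c\rangle$. An algorithm making $T$ queries consists of fixed unitaries $U_0,\dots,U_T$ (independent of $\sigma$) and produces the final state $U_TO_\sigma U_{T-1}O_\sigma\cdots U_1O_\sigma U_0|\vec 0\rangle$; it sorts with error probability at most $\epsilon$ if there is a measurement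 which, applied to this final state, yields $\sigma$ with probability at least $1-\epsilon$ for every input $\sigma$. The number of comparisons is the number $T$ of oracle applications. *)

theory Defs
  imports "Jordan_Normal_Form.Schur_Decomposition" "HOL-Combinatorics.Permutations"
begin

text \<open>Quantum query model for sorting by comparisons.
  The Hilbert space H has orthonormal basis |i,j,b,c> with i,j < n, b in {0,1},
  c in {0,1}^w (encoded as a natural number c < 2^w).  We identify H with
  complex^D, D = n*n*2*2^w, via the basis index below.\<close>

definition qdim :: "nat \<Rightarrow> nat \<Rightarrow> nat" where
  "qdim n w = n * n * 2 * 2 ^ w"

definition qidx :: "nat \<Rightarrow> nat \<Rightarrow> nat \<Rightarrow> nat \<Rightarrow> nat \<Rightarrow> nat \<Rightarrow> nat" where
  "qidx n w i j b c = ((i * n + j) * 2 + b) * 2 ^ w + c"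

definition cmp_matrix :: "(nat \<Rightarrow> nat) \<Rightarrow> nat \<Rightarrow> nat \<Rightarrow> nat" where
  "cmp_matrix \<sigma> i j = (if \<sigma> i \<le> \<sigma> j then 1 else 0)"

text \<open>Oracle gate O_sigma |i,j,b,c> = |i,j,b xor M_{i,j},c>, as a D x D matrix
  (column s is the image of basis vector s).\<close>
definition oracle_gate :: "nat \<Rightarrow> nat \<Rightarrow> (nat \<Rightarrow> nat) \<Rightarrow> complex mat" where
  "oracle_gate n w \<sigma> = mat (qdim n w) (qdim n w) (\<lambda>(r, s).
     if \<exists>i j b c. i < n \<and> j < n \<and> b < 2 \<and> c < 2 ^ w \<and> s = qidx n w i j b c
          \<and> r = qidx n w i j ((b + cmp_matrix \<sigma> i j) mod 2) c
     then 1 else 0)"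

definition unitary_mat :: "nat \<Rightarrow> complex mat \<Rightarrow> bool" where
  "unitary_mat d U \<longleftrightarrow> U \<in> carrier_mat d d \<and> U * mat_adjoint U = 1\<^sub>m d \<and> mat_adjoint U * U = 1\<^sub>m d"

fun run :: "nat \<Rightarrow> (nat \<Rightarrow> complex mat) \<Rightarrow> complex mat \<Rightarrow> nat \<Rightarrow> complex vec" where
  "run d U Or 0 = U 0 *\<^sub>v unit_vec d 0"
| "run d U Or (Suc k) = U (Suc k) *\<^sub>v (Or *\<^sub>v run d U Or k)"

definition final_state :: "nat \<Rightarrow> nat \<Rightarrow> (nat \<Rightarrow> complex mat) \<Rightarrow> nat \<Rightarrow> (nat \<Rightarrow> nat) \<Rightarrow> complex vec" where
  "final_state n w U T \<sigma> = run (qdim n w) U (oracle_gate n w \<sigma>) T"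

definition perms :: "nat \<Rightarrow> (nat \<Rightarrow> nat) set" where
  "perms n = {\<sigma>. \<sigma> permutes {..<n}}"

definition psd_mat :: "nat \<Rightarrow> complex mat \<Rightarrow> bool" where
  "psd_mat d E \<longleftrightarrow> E \<in> carrier_mat d d \<and> mat_adjoint E = E \<and>
     (\<forall>v \<in> carrier_vec d. Re (conjugate v \<bullet> (E *\<^sub>v v)) \<ge> 0)"

definition povm :: "nat \<Rightarrow> nat \<Rightarrow> ((nat \<Rightarrow> nat) \<Rightarrow> complex mat) \<Rightarrow> bool" where
  "povm n d E \<longleftrightarrow> (\<forall>\<tau> \<in> perms n. psd_mat d (E \<tau>)) \<and>
     (\<forall>r < d. \<forall>s < d. (\<Sum>\<tau> \<in> perms n. E \<tau> $$ (r, s)) = (if r = s then 1 else 0))"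

definition outcome_prob :: "complex mat \<Rightarrow> complex vec \<Rightarrow> real" where
  "outcome_prob E \<psi> = Re (conjugate \<psi> \<bullet> (E *\<^sub>v \<psi>))"

definition harmonic :: "nat \<Rightarrow> real" where
  "harmonic m = (\<Sum>i = 1..m. 1 / real i)"

end

theory Submission
  imports Defs
begin

text \<open>The proof is the weighted adversary argument of Hoyer, Neerbek and Shi. Pair each input \<open>\<sigma>\<close> with the
  inputs \<open>\<tau>\<close> obtained by moving the element of rank \<open>p\<close> down to rank \<open>k < p\<close>, with weight \<open>1 / (p - k)\<close>,
  and let \<open>W t\<close> be the weighted sum of the inner products of the states after \<open>t\<close> queries. Initially
  \<open>W 0 = n! (n H_{n-1} - n + 1)\<close>; at the end the states are nearly orthogonal, so
  \<open>|W T| \<le> 2 sqrt (\<epsilon> (1 - \<epsilon>)) W 0\<close>. The comparison matrices of \<open>\<sigma>\<close> and \<open>\<tau>\<close> differ only on the pairs of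
  positions of the elements with \<open>\<sigma>\<close>-ranks \<open>p\<close> and \<open>m\<close>, \<open>k \<le> m < p\<close>, whose \<open>\<tau>\<close>-ranks are \<open>k\<close> and \<open>m + 1\<close>.
  Hence one query changes \<open>W\<close> by a bilinear form with the Hilbert kernel \<open>1 / (u + v - 1)\<close> in
  \<open>u = p - m\<close> and \<open>v = m + 1 - k\<close>, and since
  the Hilbert matrix has norm at most \<open>\<pi>\<close>, by at most \<open>2 \<pi> n!\<close>.\<close>

subsection \<open>The Schur test for the Hilbert matrix\<close>

text \<open>The midpoint rule underestimates the integral of the convex function
  \<open>y \<mapsto> sqrt (x / y) / (x + y)\<close>, whose antiderivative is \<open>2 * arctan (sqrt (y / x))\<close>.\<close>
lemma midpoint_arctan_le:
  fixes x c h :: real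
  assumes x: "x > 0" and h: "0 < h" "h \<le> c"
  shows "2 * h * (sqrt (x / c) / (x + c)) \<le>
    2 * arctan (sqrt ((c + h) / x)) - 2 * arctan (sqrt ((c - h) / x))"
proof -
  define f where "f y = sqrt (x / y) / (x + y)" for y
  define F where "F y = 2 * arctan (sqrt (y / x))" for y
  \<comment> \<open>The gap between the integral of \<open>f\<close> over
    \<open>{c - t..c + t}\<close> and its midpoint estimate. It vanishes at 0, and its derivative
    \<open>f (c + t) + f (c - t) - 2 * f c\<close> is nonnegative by convexity.\<close>
  define g where "g t = F (c + t) - F (c - t) - 2 * t * f c" for t
  have c: "c > 0" using h by simp
  have F': "(F has_real_derivative f y) (at y)" if "y > 0" for y
  proof -
    have "(F has_real_derivative 2 * (inverse (1 + (sqrt (y / x))\<^sup>2) *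
        (inverse (sqrt (y / x)) / 2 * (1 / x)))) (at y)"
      unfolding F_def using that x
      by (auto intro!: derivative_eq_intros simp: field_simps)
    also have "2 * (inverse (1 + (sqrt (y / x))\<^sup>2) * (inverse (sqrt (y / x)) / 2 * (1 / x))) = f y"
    proof -
      have "inverse (1 + (sqrt (y / x))\<^sup>2) = x / (x + y)"
        using that x by (simp add: field_simps)
      then show ?thesis using that x by (simp add: f_def real_sqrt_divide)
    qed
    finally show ?thesis .
  qed
  have "g 0 \<le> g h"
  \<comment> \<open>Derivatives are taken in the open interval only: for \<open>h = c\<close>,
    \<open>F\<close> is merely continuous at the left end \<open>c - h = 0\<close>.\<close>
  proof (rule DERIV_nonneg_imp_increasing_open[of 0 h g])
    show "0 \<le> h" using h by simp
    show "continuous_on {0..h} g"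
      unfolding g_def F_def using x by (auto intro!: continuous_intros)
    fix t assume t: "0 < t" "t < h"
    let ?a = "c - t" and ?b = "c + t"
    have a: "0 < ?a" and b: "0 < ?b" using t h by auto
    have "(g has_real_derivative f ?b * 1 - f ?a * (-1) - 2 * f c) (at t)"
      unfolding g_def
      by (rule derivative_eq_intros DERIV_chain2[where g = "\<lambda>t. c - t", OF F'[OF a]]
          DERIV_chain2[where g = "\<lambda>t. c + t", OF F'[OF b]] refl)+ auto
    moreover have "0 \<le> f ?b * 1 - f ?a * (-1) - 2 * f c"
    proof -
      have fpos: "f ?a > 0" "f ?b > 0" "f c > 0" using a b c x by (auto simp: f_def)
      \<comment> \<open>Midpoint convexity follows from the log-convex bound
        \<open>(f c)^2 \<le> f ?a * f ?b\<close> and AM-GM.\<close>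
      have ab: "?a * ?b \<le> c\<^sup>2" by (simp add: algebra_simps power2_eq_square)
      have xx: "(x + ?a) * (x + ?b) \<le> (x + c)\<^sup>2"
        by (simp add: algebra_simps power2_eq_square)
      have "(f c)\<^sup>2 = x / (sqrt (c\<^sup>2) * (x + c)\<^sup>2)"
        using c x by (simp add: f_def power_divide)
      also have "\<dots> \<le> x / (sqrt (?a * ?b) * ((x + ?a) * (x + ?b)))"
        using a b x ab xx
        by (intro divide_left_mono mult_mono real_sqrt_le_mono mult_pos_pos) auto
      also have "\<dots> = f ?a * f ?b"
        using a b x by (simp add: f_def real_sqrt_divide real_sqrt_mult)
      finally have "(f c)\<^sup>2 \<le> f ?a * f ?b" .
      then have "(2 * f c)\<^sup>2 \<le> (f ?a + f ?b)\<^sup>2"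
        using sum_squares_bound[of "f ?a" "f ?b"] by (simp add: power2_sum power_mult_distrib)
      then have "2 * f c \<le> f ?a + f ?b"
        using fpos by (intro power2_le_imp_le[of "2 * f c" "f ?a + f ?b"]) auto
      then show ?thesis by simp
    qed
    ultimately show "\<exists>y. (g has_real_derivative y) (at t) \<and> 0 \<le> y" by blast
  qed
  then show ?thesis by (simp add: g_def F_def f_def)
qed

text \<open>The points \<open>v + 1/2\<close> are midpoints of unit cells, so the midpoint bounds
  telescope to a difference of arctangents. This is the row sum of the Schur test for the kernel
  \<open>1 / (x + y)\<close> with test vector \<open>1 / sqrt y\<close>.\<close>

lemma hilbert_schur_sum_le_pi:
  fixes x :: real
  assumes x: "x > 0"
  shows "(\<Sum>v<N. sqrt (x / (real v + 1/2)) / (x + (real v + 1/2))) \<le> pi"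
proof -
  define F where "F v = 2 * arctan (sqrt (real v / x))" for v
  have "(\<Sum>v<N. sqrt (x / (real v + 1/2)) / (x + (real v + 1/2))) \<le> (\<Sum>v<N. F (Suc v) - F v)"
  proof (rule sum_mono)
    fix v
    show "sqrt (x / (real v + 1/2)) / (x + (real v + 1/2)) \<le> F (Suc v) - F v"
      using midpoint_arctan_le[OF x, of "1/2" "real v + 1/2"]
      by (simp add: F_def add.commute)
  qed
  also have "\<dots> = F N - F 0" by (rule sum_lessThan_telescope)
  also have "\<dots> \<le> pi" using arctan_ubound[of "sqrt (real N / x)"] by (simp add: F_def)
  finally show ?thesis .
qed

subsection \<open>Cyclic shifts of ranks\<close>

definition cyc :: "nat \<Rightarrow> nat \<Rightarrow> nat \<Rightarrow> nat" where
  "cyc k p r = (if r = p then k else if k \<le> r \<and> r < p then Suc r else r)"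

lemma cyc_permutes:
  assumes "k < p" "p < n"
  shows "cyc k p permutes {..<n}"
proof (rule bij_imp_permutes)
  define ci where "ci r = (if r = k then p else if k < r \<and> r \<le> p then r - 1 else r)" for r
  show "bij_betw (cyc k p) {..<n} {..<n}"
    by (rule bij_betw_byWitness[where f' = ci]) (use assms in \<open>auto simp: cyc_def ci_def\<close>)
  show "cyc k p r = r" if "r \<notin> {..<n}" for r
    using that assms by (auto simp: cyc_def)
qed

lemma finite_perms: "finite (perms n)" and card_perms: "card (perms n) = fact n"
  by (simp_all add: perms_def finite_permutations card_permutations)

lemma cyc_comp_perms:
  "\<lbrakk>k < p; p < n; \<sigma> \<in> perms n\<rbrakk> \<Longrightarrow> cyc k p \<circ> \<sigma> \<in> perms n"
  by (auto simp: perms_def intro: permutes_compose cyc_permutes)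

lemma cyc_comp_neq: "k < p \<Longrightarrow> \<sigma> \<in> perms n \<Longrightarrow> cyc k p \<circ> \<sigma> \<noteq> \<sigma>"
proof
  assume *: "k < p" "\<sigma> \<in> perms n" "cyc k p \<circ> \<sigma> = \<sigma>"
  then obtain i where "\<sigma> i = p" by (metis mem_Collect_eq perms_def permutes_surj surjD)
  then show False using * by (metis comp_apply cyc_def less_irrefl)
qed

text \<open>Left composition is a bijection of the inputs, so weights attached to the second member
  of a pair can be summed over all inputs.\<close>

lemma sum_perms_cyc:
  assumes "k < p" "p < n"
  shows "(\<Sum>\<sigma>\<in>perms n. f (cyc k p \<circ> \<sigma>)) = (\<Sum>\<sigma>\<in>perms n. f \<sigma>)"
  unfolding perms_def
  by (rule setum_permutations_compose_left[OF cyc_permutes[OF assms], symmetric])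

text \<open>The shift keeps the relative order of all ranks other than \<open>p\<close>, and rank
  \<open>p\<close> only jumps below those in \<open>{k..<p}\<close>.\<close>

lemma cyc_cmp_neqD:
  assumes "k < p" and "cmp_matrix (cyc k p \<circ> \<sigma>) i j \<noteq> cmp_matrix \<sigma> i j"
  shows "\<exists>m\<in>{k..<p}. (\<sigma> i = p \<and> \<sigma> j = m) \<or> (\<sigma> i = m \<and> \<sigma> j = p)"
  using assms by (auto simp: cmp_matrix_def cyc_def split: if_splits)

text \<open>The inner sum is the \<open>p\<close>-th harmonic number. The value is the total weight
  of the pairs with a given first input.\<close>

lemma sum_inverse_diff:
  assumes "n \<ge> 1"
  shows "(\<Sum>p<n. \<Sum>k<p. 1 / (real p - real k)) = real n * harmonic (n - 1) - real n + 1"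
  using assms
proof (induction n rule: dec_induct)
  case base
  show ?case by (simp add: harmonic_def)
next
  case (step n)
  have "(\<Sum>k<n. 1 / (real n - real k)) = (\<Sum>i=1..n. 1 / real i)"
    by (rule sum.reindex_bij_witness[of _ "\<lambda>i. n - i" "\<lambda>k. n - k"]) (auto simp: of_nat_diff)
  moreover have "harmonic n = harmonic (n - 1) + 1 / real n"
    using step.hyps unfolding harmonic_def by (cases n) auto
  ultimately show ?case
    using step by (simp add: harmonic_def field_simps)
qed

subsection \<open>Measurements and unitaries\<close>

text \<open>\<open>?A\<close> and \<open>?B\<close> are the cosine and sine of a difference of two
  angles, so \<open>?A^2 + ?B^2 = 1\<close>, while the hypotheses force
  \<open>?B \<ge> 1 - 2 * \<epsilon>\<close>.\<close>

lemma fidelity_sum_le: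
  fixes p q \<epsilon> :: real
  assumes "\<epsilon> < 1/2" "1 - \<epsilon> \<le> p" "p \<le> 1" "0 \<le> q" "q \<le> \<epsilon>"
  shows "sqrt p * sqrt q + sqrt (1 - p) * sqrt (1 - q) \<le> 2 * sqrt (\<epsilon> * (1 - \<epsilon>))"
proof -
  let ?A = "sqrt p * sqrt q + sqrt (1 - p) * sqrt (1 - q)"
  let ?B = "sqrt p * sqrt (1 - q) - sqrt (1 - p) * sqrt q"
  have pq: "0 \<le> p" "0 \<le> 1 - p" "0 \<le> 1 - q" "0 \<le> 1 - \<epsilon>" "0 \<le> \<epsilon>" using assms by auto
  have "(1 - \<epsilon>)\<^sup>2 \<le> p * (1 - q)"
    unfolding power2_eq_square using assms by (intro mult_mono) auto
  then have 1: "1 - \<epsilon> \<le> sqrt p * sqrt (1 - q)"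
    using pq by (simp add: real_sqrt_mult[symmetric] real_le_rsqrt)
  have "(1 - p) * q \<le> \<epsilon>\<^sup>2"
    unfolding power2_eq_square using assms by (intro mult_mono) auto
  then have 2: "sqrt (1 - p) * sqrt q \<le> \<epsilon>"
    using pq by (simp add: real_sqrt_mult[symmetric] real_le_lsqrt)
  have "(1 - 2 * \<epsilon>)\<^sup>2 \<le> ?B\<^sup>2"
    using 1 2 assms by (intro power_mono) auto
  moreover have "(a * b + c * e)\<^sup>2 + (a * e - c * b)\<^sup>2 = (a\<^sup>2 + c\<^sup>2) * (b\<^sup>2 + e\<^sup>2)" for a b c e :: real
    by (simp add: power2_eq_square algebra_simps)
  then have "?A\<^sup>2 + ?B\<^sup>2 = 1" using pq assms by simp
  ultimately have "?A\<^sup>2 \<le> 4 * (\<epsilon> * (1 - \<epsilon>))"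
    by (simp add: power2_eq_square algebra_simps)
  then have "?A \<le> sqrt (4 * (\<epsilon> * (1 - \<epsilon>)))" by (rule real_le_rsqrt)
  then show ?thesis by (simp add: real_sqrt_mult)
qed

section \<open>Positive semidefinite sesquilinear forms and the overlap of distinguishable
  states\<close>

text \<open>Coefficients are a function, not a matrix, because \<open>povm\<close> states
  completeness entrywise: a sum of measurement operators becomes a sum of forms.\<close>

definition sesq :: "nat \<Rightarrow> (nat \<Rightarrow> nat \<Rightarrow> complex) \<Rightarrow> complex vec \<Rightarrow> complex vec \<Rightarrow> complex" where
  "sesq d G u v = (\<Sum>r<d. \<Sum>s<d. cnj (u $ r) * G r s * v $ s)"

lemma sesq_sum: "sesq d (\<lambda>r s. \<Sum>x\<in>A. G x r s) u v = (\<Sum>x\<in>A. sesq d (G x) u v)"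
proof (induction A rule: infinite_finite_induct)
  case (insert x A)
  then show ?case
    by (simp add: sesq_def distrib_left distrib_right sum.distrib)
qed (simp_all add: sesq_def)

lemma sesq_cnj:
  assumes "\<And>r s. r < d \<Longrightarrow> s < d \<Longrightarrow> G s r = cnj (G r s)"
  shows "sesq d G v u = cnj (sesq d G u v)"
proof -
  have "sesq d G v u = (\<Sum>s<d. \<Sum>r<d. cnj (v $ r) * G r s * u $ s)"
    unfolding sesq_def by (rule sum.swap)
  also have "\<dots> = cnj (sesq d G u v)"
    unfolding sesq_def cnj_sum
  proof (intro sum.cong refl)
    fix s r assume "s \<in> {..<d}" "r \<in> {..<d}"
    then have G: "G r s = cnj (G s r)" by (intro assms) auto
    show "cnj (v $ r) * G r s * u $ s = cnj (cnj (u $ s) * G s r * v $ r)"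
      by (simp only: G complex_cnj_mult complex_cnj_cnj mult_ac)
  qed
  finally show ?thesis .
qed

lemma sesq_add_smult:
  assumes "u \<in> carrier_vec d" "v \<in> carrier_vec d"
  shows "sesq d G (u + z \<cdot>\<^sub>v v) (u + z \<cdot>\<^sub>v v) =
    sesq d G u u + z * sesq d G u v + cnj z * sesq d G v u + cnj z * z * sesq d G v v"
proof -
  have "sesq d G (u + z \<cdot>\<^sub>v v) (u + z \<cdot>\<^sub>v v) = (\<Sum>r<d. \<Sum>s<d.
      cnj (u $ r) * G r s * u $ s + z * (cnj (u $ r) * G r s * v $ s)
      + cnj z * (cnj (v $ r) * G r s * u $ s) + cnj z * z * (cnj (v $ r) * G r s * v $ s))"
    unfolding sesq_def using assms by (auto intro!: sum.cong simp: algebra_simps)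
  then show ?thesis by (simp add: sesq_def sum.distrib sum_distrib_left)
qed

text \<open>The form is only semidefinite, so a vanishing \<open>R\<close> is a separate case;
  otherwise this is the discriminant argument for a nonnegative real quadratic.\<close>

lemma sesq_Cauchy_Schwarz:
  assumes herm: "\<And>r s. r < d \<Longrightarrow> s < d \<Longrightarrow> G s r = cnj (G r s)"
    and pos: "\<And>v. v \<in> carrier_vec d \<Longrightarrow> 0 \<le> Re (sesq d G v v)"
    and uv: "u \<in> carrier_vec d" "v \<in> carrier_vec d"
  shows "cmod (sesq d G u v) \<le> sqrt (Re (sesq d G u u)) * sqrt (Re (sesq d G v v))"
proof -
  define c P R where "c = sesq d G u v" and "P = Re (sesq d G u u)" and "R = Re (sesq d G v v)"
  have P: "0 \<le> P" and R: "0 \<le> R" using pos uv by (auto simp: P_def R_def)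
  have quad: "0 \<le> P - 2 * t * cmod c + t\<^sup>2 * R" for t :: real
  proof (cases "c = 0")
    case True
    then show ?thesis using P R by simp
  next
    case False
    \<comment> \<open>Modulus \<open>\<bar>t\<bar>\<close>, with the phase that turns both cross
      terms into \<open>- t * cmod c\<close>.\<close>
    define z where "z = - of_real t * (cnj c / of_real (cmod c))"
    have zc: "z * c = - of_real (t * cmod c)"
    proof -
      have "z * c = - of_real t * (c * cnj c) / of_real (cmod c)" by (simp add: z_def)
      also have "\<dots> = - of_real (t * cmod c)"
        unfolding complex_norm_square[symmetric] using False by (simp add: power2_eq_square)
      finally show ?thesis .
    qed
    then have zc': "cnj z * cnj c = - of_real (t * cmod c)"
      by (metis complex_cnj_complex_of_real complex_cnj_minus complex_cnj_mult)
    have "cmod z = \<bar>t\<bar>" using False by (simp add: z_def norm_mult norm_divide)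
    then have zz: "cnj z * z = of_real (t\<^sup>2)"
      by (metis complex_norm_square mult.commute power2_abs of_real_power)
    have sv: "sesq d G v u = cnj c" unfolding c_def by (rule sesq_cnj) (rule herm)
    have "sesq d G (u + z \<cdot>\<^sub>v v) (u + z \<cdot>\<^sub>v v) =
        sesq d G u u + - of_real (t * cmod c) + - of_real (t * cmod c) + of_real (t\<^sup>2) * sesq d G v v"
      by (simp only: sesq_add_smult[OF uv] sv c_def[symmetric] zc zc' zz)
    moreover have "0 \<le> Re (sesq d G (u + z \<cdot>\<^sub>v v) (u + z \<cdot>\<^sub>v v))" using pos uv by simp
    ultimately show ?thesis
      by (simp add: P_def R_def)
  qed
  have "(cmod c)\<^sup>2 \<le> P * R"
  proof (cases "R = 0")
    case True
    have "cmod c = 0"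
    proof (rule ccontr)
      assume "cmod c \<noteq> 0"
      \<comment> \<open>With \<open>R = 0\<close> the quadratic is linear in \<open>t\<close>, and
        this value makes it -1.\<close>
      then show False using quad[of "(P + 1) / (2 * cmod c)"] True P by simp
    qed
    then show ?thesis using True by simp
  next
    case False
    then have "R > 0" using R by simp
    \<comment> \<open>The minimizer of the quadratic.\<close>
    then show ?thesis using quad[of "cmod c / R"] by (simp add: field_simps power2_eq_square)
  qed
  then show ?thesis
    unfolding c_def[symmetric] P_def[symmetric] R_def[symmetric]
    unfolding real_sqrt_mult[symmetric] by (rule real_le_rsqrt)
qed

lemma scalar_prod_mult_mat_vec_sesq:
  assumes "M \<in> carrier_mat d d" "u \<in> carrier_vec d" "v \<in> carrier_vec d"
  shows "conjugate u \<bullet> (M *\<^sub>v v) = sesq d (\<lambda>r s. M $$ (r, s)) u v"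
  unfolding sesq_def scalar_prod_def using assms
  by (auto intro!: sum.cong simp: scalar_prod_def lessThan_atLeast0 sum_distrib_left mult.assoc)

lemma mat_adjoint_index:
  assumes "A \<in> carrier_mat d d" "r < d" "s < d"
  shows "mat_adjoint A $$ (r, s) = conjugate (A $$ (s, r))"
  using assms by (simp add: mat_adjoint_def mat_of_rows_index)

lemma mat_adjoint_carrier: "A \<in> carrier_mat d d \<Longrightarrow> mat_adjoint A \<in> carrier_mat d d"
  by (auto simp: mat_adjoint_def mat_of_rows_def)

text \<open>The measurement is coarsened to two outcomes, \<sigma> and not \<sigma>, and
  Cauchy-Schwarz is applied to each of the two forms.\<close>

lemma povm_overlap_le:
  assumes E: "povm n d E" and \<sigma>\<tau>: "\<sigma> \<in> perms n" "\<tau> \<in> perms n" "\<sigma> \<noteq> \<tau>" and \<epsilon>: "\<epsilon> < 1/2"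
    and u: "u \<in> carrier_vec d" "conjugate u \<bullet> u = 1" "1 - \<epsilon> \<le> outcome_prob (E \<sigma>) u"
    and v: "v \<in> carrier_vec d" "conjugate v \<bullet> v = 1" "1 - \<epsilon> \<le> outcome_prob (E \<tau>) v"
  shows "cmod (conjugate u \<bullet> v) \<le> 2 * sqrt (\<epsilon> * (1 - \<epsilon>))"
proof -
  define G where "G x r s = E x $$ (r, s)" for x and r s :: nat
  define G' where "G' r s = (\<Sum>x\<in>perms n - {\<sigma>}. G x r s)" for r s
  have Ec: "E x \<in> carrier_mat d d" "mat_adjoint (E x) = E x" if "x \<in> perms n" for x
    using E that by (auto simp: povm_def psd_mat_def)
  have herm: "G x s r = cnj (G x r s)" if "x \<in> perms n" "r < d" "s < d" for x r s
    using mat_adjoint_index[OF Ec(1)[OF that(1)], of s r] Ec(2)[OF that(1)] that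
    by (simp add: G_def)
  have herm': "G' s r = cnj (G' r s)" if "r < d" "s < d" for r s
    unfolding G'_def cnj_sum by (intro sum.cong refl herm) (use that in auto)
  have pos: "0 \<le> Re (sesq d (G x) a a)" if "x \<in> perms n" "a \<in> carrier_vec d" for x a
    using E that scalar_prod_mult_mat_vec_sesq[OF Ec(1)[OF that(1)] that(2) that(2)]
    unfolding povm_def psd_mat_def G_def by metis
  have G': "sesq d G' a b = (\<Sum>x\<in>perms n - {\<sigma>}. sesq d (G x) a b)" for a b
    unfolding G'_def by (rule sesq_sum)
  have pos': "0 \<le> Re (sesq d G' a a)" if "a \<in> carrier_vec d" for a
    unfolding G' Re_sum using pos that by (intro sum_nonneg) auto
  have split: "conjugate a \<bullet> b = sesq d (G \<sigma>) a b + sesq d G' a b"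
    if "a \<in> carrier_vec d" "b \<in> carrier_vec d" for a b
  proof -
    have "sesq d (G \<sigma>) a b + sesq d G' a b = (\<Sum>x\<in>perms n. sesq d (G x) a b)"
      unfolding G' using \<sigma>\<tau>(1) by (simp add: sum.remove finite_perms)
    also have "\<dots> = sesq d (\<lambda>r s. \<Sum>x\<in>perms n. G x r s) a b" by (rule sesq_sum[symmetric])
    also have "\<dots> = (\<Sum>r<d. \<Sum>s<d. if r = s then cnj (a $ r) * b $ s else 0)"
      unfolding sesq_def G_def
    proof (intro sum.cong refl)
      fix r s assume "r \<in> {..<d}" "s \<in> {..<d}"
      then have "(\<Sum>x\<in>perms n. E x $$ (r, s)) = (if r = s then 1 else 0)"
        using E by (simp add: povm_def)
      then show "cnj (a $ r) * (\<Sum>x\<in>perms n. E x $$ (r, s)) * b $ s =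
          (if r = s then cnj (a $ r) * b $ s else 0)" by simp
    qed
    also have "\<dots> = conjugate a \<bullet> b"
      using that by (simp add: scalar_prod_def lessThan_atLeast0)
    finally show ?thesis by simp
  qed
  have prob: "outcome_prob (E x) a = Re (sesq d (G x) a a)" if "x \<in> perms n" "a \<in> carrier_vec d" for x a
    unfolding outcome_prob_def G_def
    by (simp add: scalar_prod_mult_mat_vec_sesq[OF Ec(1)[OF that(1)] that(2) that(2)])
  define p q where "p = Re (sesq d (G \<sigma>) u u)" and "q = Re (sesq d (G \<sigma>) v v)"
  have p': "Re (sesq d G' u u) = 1 - p" and q': "Re (sesq d G' v v) = 1 - q"
    using split[OF u(1) u(1)] split[OF v(1) v(1)] u(2) v(2) by (simp_all add: p_def q_def complex_eq_iff)
  \<comment> \<open>Outcome \<tau> is part of "not \<sigma>", so the success probability on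
    \<open>v\<close> forces \<open>q \<le> \<epsilon>\<close>.\<close>
  have "Re (sesq d (G \<tau>) v v) \<le> Re (sesq d G' v v)"
    unfolding G' Re_sum using \<sigma>\<tau> finite_perms[of n] pos v(1)
    by (intro member_le_sum[of \<tau> "perms n - {\<sigma>}" "\<lambda>x. Re (sesq d (G x) v v)"]) auto
  then have q: "q \<le> \<epsilon>" using v prob[OF \<sigma>\<tau>(2) v(1)] q' by simp
  have "cmod (conjugate u \<bullet> v) \<le> cmod (sesq d (G \<sigma>) u v) + cmod (sesq d G' u v)"
    unfolding split[OF u(1) v(1)] by (rule norm_triangle_ineq)
  also have "\<dots> \<le> sqrt p * sqrt q + sqrt (1 - p) * sqrt (1 - q)"
    unfolding p_def q_def p'[unfolded p_def, symmetric] q'[unfolded q_def, symmetric]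
    by (intro add_mono sesq_Cauchy_Schwarz herm herm' pos pos' \<sigma>\<tau> u(1) v(1))
  also have "\<dots> \<le> 2 * sqrt (\<epsilon> * (1 - \<epsilon>))"
  proof (rule fidelity_sum_le[OF \<epsilon> _ _ _ q])
    show "1 - \<epsilon> \<le> p" using u prob[OF \<sigma>\<tau>(1) u(1)] by (simp add: p_def)
    show "p \<le> 1" using pos'[OF u(1)] p' by simp
    show "0 \<le> q" using pos[OF \<sigma>\<tau>(1) v(1)] by (simp add: q_def)
  qed
  finally show ?thesis .
qed

lemma unitary_mat_scalar_prod:
  assumes U: "unitary_mat d U" and u: "u \<in> carrier_vec d" and v: "v \<in> carrier_vec d"
  shows "conjugate (U *\<^sub>v u) \<bullet> (U *\<^sub>v v) = conjugate u \<bullet> v"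
proof -
  have Uc: "U \<in> carrier_mat d d" and inv: "mat_adjoint U * U = 1\<^sub>m d"
    using U by (auto simp: unitary_mat_def)
  define x where "x = U *\<^sub>v v"
  have x: "x \<in> carrier_vec d" using Uc v by (simp add: x_def)
  note Ac = mat_adjoint_carrier[OF Uc]
  have "conjugate (U *\<^sub>v u) \<bullet> x = (\<Sum>s<d. (\<Sum>r<d. cnj (U $$ (s, r)) * cnj (u $ r)) * x $ s)"
    using Uc u x by (auto intro!: sum.cong simp: scalar_prod_def lessThan_atLeast0 cnj_sum)
  also have "\<dots> = (\<Sum>r<d. \<Sum>s<d. cnj (U $$ (s, r)) * cnj (u $ r) * x $ s)"
    unfolding sum_distrib_right by (rule sum.swap)
  also have "\<dots> = sesq d (\<lambda>r s. mat_adjoint U $$ (r, s)) u x"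
    unfolding sesq_def using Uc by (auto intro!: sum.cong simp: mat_adjoint_index)
  also have "\<dots> = conjugate u \<bullet> (mat_adjoint U *\<^sub>v x)"
    using scalar_prod_mult_mat_vec_sesq[OF Ac u x] by simp
  also have "mat_adjoint U *\<^sub>v x = v"
    unfolding x_def assoc_mult_mat_vec[OF Ac Uc v, symmetric] inv using v by simp
  finally show ?thesis by (simp add: x_def)
qed

subsection \<open>The effect of one query\<close>

text \<open>A mixed-radix expansion with bases \<open>n\<close>, \<open>n\<close>, \<open>2\<close>,
  \<open>2 ^ w\<close>; the witness reads off the digits.\<close>

lemma qidx_bij:
  "bij_betw (\<lambda>(i, j, b, c). qidx n w i j b c)
     ({..<n} \<times> {..<n} \<times> {..<2} \<times> {..<2 ^ w}) {..<qdim n w}"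
proof (rule bij_betw_byWitness[where f' =
      "\<lambda>r. (r div 2 ^ w div 2 div n, r div 2 ^ w div 2 mod n, r div 2 ^ w mod 2, r mod 2 ^ w)"])
  show "(\<lambda>(i, j, b, c). qidx n w i j b c) ` ({..<n} \<times> {..<n} \<times> {..<2} \<times> {..<2 ^ w}) \<subseteq> {..<qdim n w}"
  proof -
    have lt: "x * N + y < M * N" if "x < M" "y < N" for x y N M :: nat
    proof -
      have "x * N + y < Suc x * N" using that by simp
      also have "\<dots> \<le> M * N" using that by (intro mult_le_mono1) simp
      finally show ?thesis .
    qed
    have "qidx n w i j b c < qdim n w" if "i < n" "j < n" "b < 2" "c < 2 ^ w" for i j b c
      unfolding qidx_def qdim_def by (intro lt that)
    then show ?thesis by auto
  qed
  show "(\<lambda>r. (r div 2 ^ w div 2 div n, r div 2 ^ w div 2 mod n, r div 2 ^ w mod 2, r mod 2 ^ w)) `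
      {..<qdim n w} \<subseteq> {..<n} \<times> {..<n} \<times> {..<2} \<times> {..<2 ^ w}"
    by (cases "n = 0") (auto simp: qdim_def intro!: less_mult_imp_div_less)
  have dm: "(x * N + y) div N = x" "(x * N + y) mod N = y" if "y < N" for x y N :: nat
    using that by simp_all
  show "\<forall>a\<in>{..<n} \<times> {..<n} \<times> {..<2} \<times> {..<2 ^ w}.
      (\<lambda>r. (r div 2 ^ w div 2 div n, r div 2 ^ w div 2 mod n, r div 2 ^ w mod 2, r mod 2 ^ w))
        (case a of (i, j, b, c) \<Rightarrow> qidx n w i j b c) = a"
    by (clarify, simp only: prod.case qidx_def dm lessThan_iff)
  show "\<forall>r\<in>{..<qdim n w}. (case (r div 2 ^ w div 2 div n, r div 2 ^ w div 2 mod n, r div 2 ^ w mod 2,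
      r mod 2 ^ w) of (i, j, b, c) \<Rightarrow> qidx n w i j b c) = r"
    by (simp only: prod.case qidx_def div_mult_mod_eq ball_triv simp_thms)
qed

lemma qidx_less: "i < n \<Longrightarrow> j < n \<Longrightarrow> b < 2 \<Longrightarrow> c < 2 ^ w \<Longrightarrow> qidx n w i j b c < qdim n w"
  using bij_betwE[OF qidx_bij[of n w]] by force

lemma qidx_inject:
  assumes "i < n" "j < n" "b < 2" "c < 2 ^ w" "i' < n" "j' < n" "b' < 2" "c' < 2 ^ w"
    and "qidx n w i j b c = qidx n w i' j' b' c'"
  shows "i = i' \<and> j = j' \<and> b = b' \<and> c = c'"
  using inj_onD[OF bij_betw_imp_inj_on[OF qidx_bij[of n w]], of "(i, j, b, c)" "(i', j', b', c')"] assms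
  by simp

lemma sum_qdim:
  "(\<Sum>r<qdim n w. f r) = (\<Sum>i<n. \<Sum>j<n. \<Sum>b<2. \<Sum>c<2 ^ w. f (qidx n w i j b c))"
  unfolding sum.reindex_bij_betw[OF qidx_bij[of n w], symmetric]
  by (simp add: sum.cartesian_product case_prod_unfold)

lemma oracle_gate_carrier: "oracle_gate n w \<sigma> \<in> carrier_mat (qdim n w) (qdim n w)"
  by (simp add: oracle_gate_def)

text \<open>Adding a fixed bit modulo 2 is an involution, so the only nonzero entry of a row sits in
  the column given by the same xor.\<close>

lemma oracle_gate_mult_vec:
  assumes v: "v \<in> carrier_vec (qdim n w)" and l: "i < n" "j < n" "b < 2" "c < 2 ^ w"
  shows "(oracle_gate n w \<sigma> *\<^sub>v v) $ qidx n w i j b c =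
    v $ qidx n w i j ((b + cmp_matrix \<sigma> i j) mod 2) c"
proof -
  let ?r = "qidx n w i j b c" and ?s = "qidx n w i j ((b + cmp_matrix \<sigma> i j) mod 2) c"
  have r: "?r < qdim n w" and s: "?s < qdim n w" using l by (auto intro: qidx_less)
  have *: "(\<exists>i j b c. i < n \<and> j < n \<and> b < 2 \<and> c < 2 ^ w \<and> s = qidx n w i j b c
          \<and> ?r = qidx n w i j ((b + cmp_matrix \<sigma> i j) mod 2) c) \<longleftrightarrow> s = ?s" for s
  proof
    assume "\<exists>i j b c. i < n \<and> j < n \<and> b < 2 \<and> c < 2 ^ w \<and> s = qidx n w i j b c
          \<and> ?r = qidx n w i j ((b + cmp_matrix \<sigma> i j) mod 2) c"
    then obtain i' j' b' c' where l': "i' < n" "j' < n" "b' < 2" "c' < 2 ^ w"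
      and s: "s = qidx n w i' j' b' c'"
      and r: "?r = qidx n w i' j' ((b' + cmp_matrix \<sigma> i' j') mod 2) c'" by blast
    have "i = i' \<and> j = j' \<and> b = (b' + cmp_matrix \<sigma> i' j') mod 2 \<and> c = c'"
      using l l' r by (intro qidx_inject[of i n j b c w]) auto
    moreover from this have "b' = (b + cmp_matrix \<sigma> i j) mod 2"
      using l'(3) by (auto simp: cmp_matrix_def less_2_cases_iff)
    ultimately show "s = ?s" using s by simp
  next
    assume "s = ?s"
    moreover have "b = ((b + cmp_matrix \<sigma> i j) mod 2 + cmp_matrix \<sigma> i j) mod 2"
      using l(3) by (auto simp: cmp_matrix_def less_2_cases_iff)
    ultimately show "\<exists>i j b c. i < n \<and> j < n \<and> b < 2 \<and> c < 2 ^ w \<and> s = qidx n w i j b c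
          \<and> ?r = qidx n w i j ((b + cmp_matrix \<sigma> i j) mod 2) c"
      using l by (intro exI[of _ i] exI[of _ j] exI[of _ "(b + cmp_matrix \<sigma> i j) mod 2"] exI[of _ c]) auto
  qed
  have "(oracle_gate n w \<sigma> *\<^sub>v v) $ ?r = (\<Sum>s<qdim n w. oracle_gate n w \<sigma> $$ (?r, s) * v $ s)"
    using r v oracle_gate_carrier[of n w \<sigma>] by (simp add: scalar_prod_def lessThan_atLeast0)
  also have "\<dots> = (\<Sum>s<qdim n w. if s = ?s then v $ s else 0)"
  proof (intro sum.cong refl)
    fix s assume "s \<in> {..<qdim n w}"
    then have s: "s < qdim n w" by simp
    have "oracle_gate n w \<sigma> $$ (?r, s) = (if s = ?s then 1 else 0)"
      by (simp only: oracle_gate_def index_mat(1)[OF r s] prod.case *)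
    then show "oracle_gate n w \<sigma> $$ (?r, s) * v $ s = (if s = ?s then v $ s else 0)" by simp
  qed
  also have "\<dots> = v $ ?s" using s by simp
  finally show ?thesis .
qed

text \<open>For a unit vector, the probability that the query register holds the pair
  \<open>(i, j)\<close>.\<close>

definition block_weight :: "nat \<Rightarrow> nat \<Rightarrow> complex vec \<Rightarrow> nat \<Rightarrow> nat \<Rightarrow> real" where
  "block_weight n w u i j = (\<Sum>b<2. \<Sum>c<2 ^ w. (cmod (u $ qidx n w i j b c))\<^sup>2)"

lemma block_weight_nonneg: "0 \<le> block_weight n w u i j"
  by (simp add: block_weight_def sum_nonneg)

lemma sum_block_weight:
  assumes "u \<in> carrier_vec (qdim n w)"
  shows "(\<Sum>i<n. \<Sum>j<n. block_weight n w u i j) = Re (conjugate u \<bullet> u)"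
proof -
  have "conjugate u \<bullet> u = (\<Sum>r<qdim n w. cnj (u $ r) * u $ r)"
    using assms by (simp add: scalar_prod_def lessThan_atLeast0)
  also have "\<dots> = (\<Sum>r<qdim n w. of_real ((cmod (u $ r))\<^sup>2))"
    by (intro sum.cong refl) (simp only: complex_norm_square mult.commute)
  finally have "Re (conjugate u \<bullet> u) = (\<Sum>r<qdim n w. (cmod (u $ r))\<^sup>2)" by simp
  then show ?thesis by (simp add: sum_qdim block_weight_def)
qed

lemma sum_xor_bit:
  fixes f :: "nat \<Rightarrow> 'a :: comm_monoid_add"
  assumes "m < 2"
  shows "(\<Sum>b<2. f ((b + m) mod 2)) = (\<Sum>b<2::nat. f b)"
proof -
  have S: "(\<Sum>b<2. g b) = g 0 + g 1" for g :: "nat \<Rightarrow> 'a"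
  proof -
    have "{..<2::nat} = {0, 1}" by (auto simp: less_2_cases_iff)
    then show ?thesis by simp
  qed
  from less_2_cases[OF assms] show ?thesis
  proof
    assume "m = Suc 0"
    then show ?thesis unfolding S by (simp add: add.commute)
  qed (simp add: S)
qed

lemma cmp_matrix_less: "cmp_matrix \<sigma> i j < 2"
  by (simp add: cmp_matrix_def)

text \<open>AM-GM with a free parameter \<open>h\<close>, later chosen as the weight of the Schur
  test.\<close>

lemma norm_cnj_mult_le:
  assumes "h > 0"
  shows "cmod (cnj a * b) \<le> (h * (cmod a)\<^sup>2 + (cmod b)\<^sup>2 / h) / 2"
proof -
  have "0 \<le> (sqrt h * cmod a - cmod b / sqrt h)\<^sup>2" by simp
  also have "\<dots> = h * (cmod a)\<^sup>2 + (cmod b)\<^sup>2 / h - 2 * (cmod a * cmod b)"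
    using assms by (simp add: power2_diff power_mult_distrib power_divide)
  finally show ?thesis by (simp add: norm_mult)
qed

text \<open>The gates only permute \<open>b\<close> inside each block \<open>(i, j)\<close>, so
  blocks where both matrices agree cancel. In the others, each inner product costs half of the
  weighted AM-GM bound.\<close>

lemma oracle_gate_scalar_prod_diff:
  fixes u v :: "complex vec"
  assumes u: "u \<in> carrier_vec (qdim n w)" and v: "v \<in> carrier_vec (qdim n w)"
    and h: "\<And>i j. h i j > 0"
  shows "cmod (conjugate u \<bullet> v - conjugate (oracle_gate n w \<sigma> *\<^sub>v u) \<bullet> (oracle_gate n w \<tau> *\<^sub>v v)) \<le>
    (\<Sum>i<n. \<Sum>j<n. if cmp_matrix \<tau> i j = cmp_matrix \<sigma> i j then 0
       else h i j * block_weight n w u i j + block_weight n w v i j / h i j)"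
proof -
  define P where "P i j = (\<Sum>b<2. \<Sum>c<2 ^ w. cnj (u $ qidx n w i j b c) * v $ qidx n w i j b c)" for i j
  define Q where "Q i j = (\<Sum>b<2. \<Sum>c<2 ^ w.
    cnj (u $ qidx n w i j ((b + cmp_matrix \<sigma> i j) mod 2) c) *
    v $ qidx n w i j ((b + cmp_matrix \<tau> i j) mod 2) c)" for i j
  have 1: "conjugate u \<bullet> v = (\<Sum>i<n. \<Sum>j<n. P i j)"
    using u v by (simp add: scalar_prod_def lessThan_atLeast0[symmetric] sum_qdim P_def qidx_less)
  have 2: "conjugate (oracle_gate n w \<sigma> *\<^sub>v u) \<bullet> (oracle_gate n w \<tau> *\<^sub>v v) = (\<Sum>i<n. \<Sum>j<n. Q i j)"
  proof -
    have "conjugate (oracle_gate n w \<sigma> *\<^sub>v u) \<bullet> (oracle_gate n w \<tau> *\<^sub>v v) =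
      (\<Sum>r<qdim n w. cnj ((oracle_gate n w \<sigma> *\<^sub>v u) $ r) * (oracle_gate n w \<tau> *\<^sub>v v) $ r)"
      using oracle_gate_carrier[of n w \<sigma>] oracle_gate_carrier[of n w \<tau>]
      unfolding scalar_prod_def by (intro sum.cong) auto
    also have "\<dots> = (\<Sum>i<n. \<Sum>j<n. Q i j)"
      unfolding sum_qdim Q_def
      by (intro sum.cong refl) (simp add: oracle_gate_mult_vec[OF u] oracle_gate_mult_vec[OF v])
    finally show ?thesis .
  qed
  have eq: "Q i j = P i j" if "cmp_matrix \<tau> i j = cmp_matrix \<sigma> i j" for i j
    unfolding Q_def P_def that
    by (rule sum_xor_bit[OF cmp_matrix_less, where f = "\<lambda>b. \<Sum>c<2 ^ w. cnj (u $ qidx n w i j b c) * v $ qidx n w i j b c"])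
  have bound: "cmod (P i j) \<le> (h i j * block_weight n w u i j + block_weight n w v i j / h i j) / 2"
    "cmod (Q i j) \<le> (h i j * block_weight n w u i j + block_weight n w v i j / h i j) / 2" for i j
  proof -
    let ?U = "\<lambda>b c. (cmod (u $ qidx n w i j b c))\<^sup>2" and ?V = "\<lambda>b c. (cmod (v $ qidx n w i j b c))\<^sup>2"
    let ?x = "cmp_matrix \<sigma> i j" and ?y = "cmp_matrix \<tau> i j"
    have "cmod (P i j) \<le> (\<Sum>b<2. \<Sum>c<2 ^ w. (h i j * ?U b c + ?V b c / h i j) / 2)"
      unfolding P_def by (intro sum_norm_le norm_cnj_mult_le h)
    also have "\<dots> = (h i j * block_weight n w u i j + block_weight n w v i j / h i j) / 2"
      unfolding block_weight_def
      by (simp only: sum.distrib sum_distrib_left sum_divide_distrib add_divide_distrib)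
    finally show "cmod (P i j) \<le> (h i j * block_weight n w u i j + block_weight n w v i j / h i j) / 2" .
    have "cmod (Q i j) \<le> (\<Sum>b<2. \<Sum>c<2 ^ w.
        (h i j * ?U ((b + ?x) mod 2) c + ?V ((b + ?y) mod 2) c / h i j) / 2)"
      unfolding Q_def by (intro sum_norm_le norm_cnj_mult_le h)
    also have "\<dots> = (h i j * (\<Sum>b<2. \<Sum>c<2 ^ w. ?U ((b + ?x) mod 2) c)
        + (\<Sum>b<2. \<Sum>c<2 ^ w. ?V ((b + ?y) mod 2) c) / h i j) / 2"
      by (simp only: sum.distrib sum_distrib_left sum_divide_distrib add_divide_distrib)
    also have "\<dots> = (h i j * block_weight n w u i j + block_weight n w v i j / h i j) / 2"
      unfolding block_weight_def
      by (simp only: sum_xor_bit[OF cmp_matrix_less, where f = "\<lambda>b. \<Sum>c<2 ^ w. ?U b c"] sum_xor_bit[OF cmp_matrix_less, where f = "\<lambda>b. \<Sum>c<2 ^ w. ?V b c"])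
    finally show "cmod (Q i j) \<le> (h i j * block_weight n w u i j + block_weight n w v i j / h i j) / 2" .
  qed
  have diff: "conjugate u \<bullet> v - conjugate (oracle_gate n w \<sigma> *\<^sub>v u) \<bullet> (oracle_gate n w \<tau> *\<^sub>v v) =
      (\<Sum>i<n. \<Sum>j<n. P i j - Q i j)"
    by (simp only: 1 2 sum_subtractf)
  show ?thesis
    unfolding diff
  proof (rule sum_norm_le, rule sum_norm_le)
    fix i j
    show "cmod (P i j - Q i j) \<le> (if cmp_matrix \<tau> i j = cmp_matrix \<sigma> i j then 0
       else h i j * block_weight n w u i j + block_weight n w v i j / h i j)"
      by (use eq[of i j] bound[of i j] norm_triangle_ineq4[of "P i j" "Q i j"] in simp)
  qed
qed

text \<open>The squared amplitude on queries comparing the elements of ranks \<open>p\<close> and \<open>q\<close>, in either order.\<close>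
definition rank_weight :: "nat \<Rightarrow> nat \<Rightarrow> (nat \<Rightarrow> nat) \<Rightarrow> complex vec \<Rightarrow> nat \<Rightarrow> nat \<Rightarrow> real" where
  "rank_weight n w \<sigma> u p q =
     block_weight n w u (Hilbert_Choice.inv \<sigma> p) (Hilbert_Choice.inv \<sigma> q) + block_weight n w u (Hilbert_Choice.inv \<sigma> q) (Hilbert_Choice.inv \<sigma> p)"

lemma rank_weight_nonneg: "0 \<le> rank_weight n w \<sigma> u p q"
  by (simp add: rank_weight_def block_weight_nonneg)

lemma rank_weight_commute: "rank_weight n w \<sigma> u p q = rank_weight n w \<sigma> u q p"
  by (simp add: rank_weight_def)

text \<open>The two sides differ by the diagonal, which stands for queries comparing an element with
  itself.\<close>

lemma sum_lower_triangle_le: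
  fixes s :: "nat \<Rightarrow> nat \<Rightarrow> real"
  assumes "\<And>p q. 0 \<le> s p q"
  shows "(\<Sum>p<n. \<Sum>q<p. s p q + s q p) \<le> (\<Sum>p<n. \<Sum>q<n. s p q)"
proof (induction n)
  case (Suc n)
  then show ?case using assms[of n n] by (simp add: sum.distrib)
qed simp

lemma sum_permutes_inv:
  assumes "\<sigma> \<in> perms n"
  shows "(\<Sum>i<n. f i) = (\<Sum>p<n. f (Hilbert_Choice.inv \<sigma> p))"
  using assms sum.permute[OF permutes_inv, of \<sigma> "{..<n}" f] by (simp add: perms_def)

lemma sum_sum_permutes_inv:
  assumes "\<sigma> \<in> perms n"
  shows "(\<Sum>i<n. \<Sum>j<n. f i j) = (\<Sum>p<n. \<Sum>q<n. f (Hilbert_Choice.inv \<sigma> p) (Hilbert_Choice.inv \<sigma> q))"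
  by (subst sum_permutes_inv[OF assms]) (intro sum.cong refl sum_permutes_inv[OF assms])

lemma sum_rank_weight_le:
  assumes "\<sigma> \<in> perms n" "u \<in> carrier_vec (qdim n w)"
  shows "(\<Sum>p<n. \<Sum>q<p. rank_weight n w \<sigma> u p q) \<le> Re (conjugate u \<bullet> u)"
proof -
  have "(\<Sum>p<n. \<Sum>q<p. rank_weight n w \<sigma> u p q) \<le>
      (\<Sum>p<n. \<Sum>q<n. block_weight n w u (Hilbert_Choice.inv \<sigma> p) (Hilbert_Choice.inv \<sigma> q))"
    unfolding rank_weight_def by (rule sum_lower_triangle_le) (rule block_weight_nonneg)
  also have "\<dots> = Re (conjugate u \<bullet> u)"
    unfolding sum_block_weight[OF assms(2), symmetric]
    by (rule sum_sum_permutes_inv[OF assms(1), symmetric])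
  finally show ?thesis .
qed

text \<open>Positions are reindexed by their \<sigma>-ranks; only the ordered pairs formed from
  \<open>p\<close> and some \<open>m\<close> in \<open>{k..<p}\<close> survive. The weights of
  \<open>v\<close> are then read off in the ranks of the shifted input.\<close>

lemma oracle_gate_cyc_scalar_prod_diff:
  fixes u v :: "complex vec"
  assumes \<sigma>: "\<sigma> \<in> perms n" and kp: "k < p" "p < n"
    and u: "u \<in> carrier_vec (qdim n w)" and v: "v \<in> carrier_vec (qdim n w)"
    and h: "\<And>m. h m > 0"
  shows "cmod (conjugate u \<bullet> v -
      conjugate (oracle_gate n w \<sigma> *\<^sub>v u) \<bullet> (oracle_gate n w (cyc k p \<circ> \<sigma>) *\<^sub>v v)) \<le>
    (\<Sum>m\<in>{k..<p}. h m * rank_weight n w \<sigma> u p m + rank_weight n w (cyc k p \<circ> \<sigma>) v k (Suc m) / h m)"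
proof -
  let ?\<tau> = "cyc k p \<circ> \<sigma>"
  have perm: "\<sigma> permutes {..<n}" using \<sigma> by (simp add: perms_def)
  have perm\<tau>: "?\<tau> permutes {..<n}" using cyc_comp_perms[OF kp \<sigma>] by (simp add: perms_def)
  have \<sigma>inv: "\<sigma> (Hilbert_Choice.inv \<sigma> q) = q" for q by (rule permutes_inverses(1)[OF perm])
  \<comment> \<open>Since \<open>m < p\<close>, the minimum recovers \<open>m\<close> from the pair
    in either order.\<close>
  define F where "F i j = (if cmp_matrix ?\<tau> i j = cmp_matrix \<sigma> i j then 0
       else h (min (\<sigma> i) (\<sigma> j)) * block_weight n w u i j
         + block_weight n w v i j / h (min (\<sigma> i) (\<sigma> j)))" for i j
  define G where "G a b = F (Hilbert_Choice.inv \<sigma> a) (Hilbert_Choice.inv \<sigma> b)" for a b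
  let ?D1 = "Pair p ` {k..<p}" and ?D2 = "(\<lambda>m. (m, p)) ` {k..<p}"
  have F0: "0 \<le> F i j" for i j
    using h[of "min (\<sigma> i) (\<sigma> j)"] by (simp add: F_def block_weight_nonneg)
  have "cmod (conjugate u \<bullet> v - conjugate (oracle_gate n w \<sigma> *\<^sub>v u) \<bullet> (oracle_gate n w ?\<tau> *\<^sub>v v))
      \<le> (\<Sum>i<n. \<Sum>j<n. F i j)"
    unfolding F_def by (rule oracle_gate_scalar_prod_diff[OF u v h])
  also have "\<dots> = (\<Sum>a<n. \<Sum>b<n. G a b)"
    unfolding G_def by (rule sum_sum_permutes_inv[OF \<sigma>])
  also have "\<dots> = (\<Sum>(a, b)\<in>{..<n} \<times> {..<n}. G a b)" by (rule sum.cartesian_product)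
  also have "\<dots> = (\<Sum>(a, b)\<in>?D1 \<union> ?D2. G a b)"
  proof (rule sum.mono_neutral_right)
    show "?D1 \<union> ?D2 \<subseteq> {..<n} \<times> {..<n}" using kp by auto
    show "\<forall>x\<in>{..<n} \<times> {..<n} - (?D1 \<union> ?D2). (case x of (a, b) \<Rightarrow> G a b) = 0"
    proof
      fix x assume x: "x \<in> {..<n} \<times> {..<n} - (?D1 \<union> ?D2)"
      obtain a b where ab: "x = (a, b)" by fastforce
      have "(a, b) \<notin> ?D1 \<union> ?D2" using x ab by simp
      then have "G a b = 0"
        using cyc_cmp_neqD[OF kp(1), of \<sigma> "Hilbert_Choice.inv \<sigma> a" "Hilbert_Choice.inv \<sigma> b"]
        by (auto simp: G_def F_def \<sigma>inv)
      then show "(case x of (a, b) \<Rightarrow> G a b) = 0" by (simp add: ab)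
    qed
  qed simp
  also have "\<dots> = (\<Sum>(a, b)\<in>?D1. G a b) + (\<Sum>(a, b)\<in>?D2. G a b)"
    by (rule sum.union_disjoint) auto
  also have "\<dots> = (\<Sum>m\<in>{k..<p}. G p m + G m p)"
    by (simp add: sum.reindex inj_on_def sum.distrib)
  also have "\<dots> \<le> (\<Sum>m\<in>{k..<p}. h m * rank_weight n w \<sigma> u p m + rank_weight n w ?\<tau> v k (Suc m) / h m)"
  proof (rule sum_mono)
    fix m assume m: "m \<in> {k..<p}"
    \<comment> \<open>The same two positions carry ranks \<open>p\<close> and \<open>m\<close>
      before the shift, \<open>k\<close> and \<open>Suc m\<close> after it.\<close>
    have \<tau>inv: "Hilbert_Choice.inv ?\<tau> k = Hilbert_Choice.inv \<sigma> p" "Hilbert_Choice.inv ?\<tau> (Suc m) = Hilbert_Choice.inv \<sigma> m"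
      using m by (simp_all add: permutes_inv_eq[OF perm\<tau>] \<sigma>inv cyc_def)
    have hn: "0 \<le> h m" using h[of m] by simp
    have "G p m \<le> h m * block_weight n w u (Hilbert_Choice.inv \<sigma> p) (Hilbert_Choice.inv \<sigma> m) + block_weight n w v (Hilbert_Choice.inv \<sigma> p) (Hilbert_Choice.inv \<sigma> m) / h m"
      "G m p \<le> h m * block_weight n w u (Hilbert_Choice.inv \<sigma> m) (Hilbert_Choice.inv \<sigma> p) + block_weight n w v (Hilbert_Choice.inv \<sigma> m) (Hilbert_Choice.inv \<sigma> p) / h m"
      using m hn by (auto simp: G_def F_def \<sigma>inv min_def block_weight_nonneg)
    then show "G p m + G m p \<le>
        h m * rank_weight n w \<sigma> u p m + rank_weight n w ?\<tau> v k (Suc m) / h m"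
      by (simp add: rank_weight_def \<tau>inv add_divide_distrib algebra_simps)
  qed
  finally show ?thesis .
qed

section \<open>Reindexing the triple sum and applying the Schur test\<close>

text \<open>Makes \<open>k\<close> the innermost variable, so that the weight at
  \<open>(p, m)\<close> can be factored out.\<close>

lemma sum_triple_inner:
  fixes f :: "nat \<Rightarrow> nat \<Rightarrow> nat \<Rightarrow> 'a :: comm_monoid_add"
  shows "(\<Sum>p<n. \<Sum>k<p. \<Sum>m\<in>{k..<p}. f p k m) = (\<Sum>p<n. \<Sum>m<p. \<Sum>k<Suc m. f p k m)"
proof (rule sum.cong[OF refl])
  fix p
  show "(\<Sum>k<p. \<Sum>m\<in>{k..<p}. f p k m) = (\<Sum>m<p. \<Sum>k<Suc m. f p k m)"
    unfolding sum.Sigma[OF finite_lessThan ballI[OF finite_atLeastLessThan]]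
      sum.Sigma[OF finite_lessThan ballI[OF finite_lessThan]]
    by (rule sum.reindex_bij_witness[where i = "\<lambda>(m, k). (k, m)" and j = "\<lambda>(k, m). (m, k)"]) auto
qed

text \<open>With \<open>q = Suc m\<close> and \<open>p = q + v\<close>, makes \<open>p\<close> vary
  innermost, so that the weight at \<open>(k, q)\<close> can be factored out.\<close>

lemma sum_triple_outer:
  fixes f :: "nat \<Rightarrow> nat \<Rightarrow> nat \<Rightarrow> 'a :: comm_monoid_add"
  shows "(\<Sum>p<n. \<Sum>k<p. \<Sum>m\<in>{k..<p}. f p k m) = (\<Sum>q<n. \<Sum>k<q. \<Sum>v<n - q. f (q + v) k (q - 1))"
proof -
  have "(\<Sum>p<n. \<Sum>k<p. \<Sum>m\<in>{k..<p}. f p k m) =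
      (\<Sum>(p, k, m)\<in>(SIGMA p:{..<n}. SIGMA k:{..<p}. {k..<p}). f p k m)"
    by (simp add: sum.Sigma)
  also have "\<dots> = (\<Sum>(q, k, v)\<in>(SIGMA q:{..<n}. SIGMA k:{..<q}. {..<n - q}). f (q + v) k (q - 1))"
    by (rule sum.reindex_bij_witness[where i = "\<lambda>(q, k, v). (q + v, k, q - 1)"
        and j = "\<lambda>(p, k, m). (Suc m, k, p - Suc m)"]) auto
  also have "\<dots> = (\<Sum>q<n. \<Sum>k<q. \<Sum>v<n - q. f (q + v) k (q - 1))"
    by (simp add: sum.Sigma)
  finally show ?thesis .
qed

text \<open>The factor \<open>sqrt (x / y)\<close> of the Schur test for the Hilbert kernel \<open>1 / (x + y) = 1 / (p - k)\<close>, with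
  \<open>x = p - m - 1/2\<close> and \<open>y = m - k + 1/2\<close>; the value 1 outside \<open>k \<le> m < p\<close> only keeps it positive.\<close>
definition hilbert_weight :: "nat \<Rightarrow> nat \<Rightarrow> nat \<Rightarrow> real" where
  "hilbert_weight p k m =
     (if k \<le> m \<and> m < p then sqrt ((real p - real m - 1/2) / (real m - real k + 1/2)) else 1)"

lemma hilbert_weight_pos: "0 < hilbert_weight p k m"
proof -
  have "0 < (real p - real m - 1/2) / (real m - real k + 1/2)" if "k \<le> m" "m < p"
  proof -
    have "real k \<le> real m" "real m + 1 \<le> real p" using that by linarith+
    then show ?thesis by simp
  qed
  then show ?thesis by (simp add: hilbert_weight_def)
qed

text \<open>The first summand is summed over \<open>k\<close> with \<open>(p, m)\<close> fixed, the
  second over \<open>p\<close> with \<open>(k, m)\<close> fixed. Each is a Schur row sum costing a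
  factor \<open>pi\<close>.\<close>

lemma hilbert_weight_sum_le:
  fixes R :: "nat \<Rightarrow> nat \<Rightarrow> real"
  assumes R: "\<And>p q. 0 \<le> R p q" and sym: "\<And>p q. R p q = R q p"
    and total: "(\<Sum>p<n. \<Sum>q<p. R p q) \<le> N"
  shows "(\<Sum>p<n. \<Sum>k<p. \<Sum>m\<in>{k..<p}. 1 / (real p - real k) *
    (hilbert_weight p k m * R p m + R k (Suc m) / hilbert_weight p k m)) \<le> 2 * pi * N"
proof -
  have 1: "(\<Sum>k<Suc m. 1 / (real p - real k) * (hilbert_weight p k m * R p m)) \<le> pi * R p m"
    if "m < p" for p m
  proof -
    define x where "x = real p - real m - 1/2"
    have x: "x > 0" using that by (simp add: x_def)
    define g where "g v = sqrt (x / (real v + 1/2)) / (x + (real v + 1/2))" for v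
    \<comment> \<open>Here \<open>y = v + 1/2\<close> with \<open>v = m - k\<close>, written as
      \<open>Suc m - Suc k\<close> to match the reversal of the sum.\<close>
    have "1 / (real p - real k) * hilbert_weight p k m = g (Suc m - Suc k)" if "k < Suc m" for k
    proof -
      have "real (m - k) = real m - real k" using that by simp
      then show ?thesis
        using that \<open>m < p\<close> by (simp add: hilbert_weight_def g_def x_def)
    qed
    then have "(\<Sum>k<Suc m. 1 / (real p - real k) * (hilbert_weight p k m * R p m)) =
        (\<Sum>k<Suc m. g (Suc m - Suc k) * R p m)"
      by (intro sum.cong refl) (simp only: mult.assoc[symmetric] lessThan_iff)
    also have "\<dots> = (\<Sum>v<Suc m. g v) * R p m"
      unfolding sum_distrib_right[symmetric] sum.nat_diff_reindex ..
    also have "\<dots> \<le> pi * R p m"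
      unfolding g_def by (intro mult_right_mono hilbert_schur_sum_le_pi x R)
    finally show ?thesis .
  qed
  have 2: "(\<Sum>v<n - q. 1 / (real (q + v) - real k) * (R k (Suc (q - 1)) / hilbert_weight (q + v) k (q - 1)))
      \<le> pi * R q k" if "k < q" for k q
  proof -
    \<comment> \<open>Equals \<open>m - k + 1/2\<close> for \<open>m = q - 1\<close>; the other
      variable \<open>p - m - 1/2\<close> becomes \<open>v + 1/2\<close>.\<close>
    define y where "y = real q - real k - 1/2"
    have y: "y > 0" using that by (simp add: y_def)
    define g where "g v = sqrt (y / (real v + 1/2)) / (y + (real v + 1/2))" for v
    have gv: "1 / (real (q + v) - real k) / hilbert_weight (q + v) k (q - 1) = g v" for v
    proof -
      have q: "real (q - 1) = real q - 1" using that by simp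
      have "hilbert_weight (q + v) k (q - 1) = sqrt ((real v + 1/2) / y)"
      proof -
        have "k \<le> q - 1" "q - 1 < q + v" using that by auto
        then show ?thesis by (simp add: hilbert_weight_def q y_def del: One_nat_def)
      qed
      moreover have "real (q + v) - real k = y + (real v + 1/2)" by (simp add: y_def)
      ultimately show ?thesis by (simp add: g_def real_sqrt_divide)
    qed
    have "Suc (q - 1) = q" using that by simp
    have "Suc (q - 1) = q" using that by simp
    then have "(\<Sum>v<n - q. 1 / (real (q + v) - real k) *
          (R k (Suc (q - 1)) / hilbert_weight (q + v) k (q - 1))) = (\<Sum>v<n - q. g v * R q k)"
      using sym[of k q] by (intro sum.cong refl) (simp add: gv[symmetric] del: of_nat_add)
    also have "\<dots> \<le> pi * R q k"
      unfolding sum_distrib_right[symmetric] g_def by (intro mult_right_mono hilbert_schur_sum_le_pi y R)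
    finally show ?thesis .
  qed
  have "(\<Sum>p<n. \<Sum>k<p. \<Sum>m\<in>{k..<p}. 1 / (real p - real k) *
      (hilbert_weight p k m * R p m + R k (Suc m) / hilbert_weight p k m)) =
    (\<Sum>p<n. \<Sum>k<p. \<Sum>m\<in>{k..<p}. 1 / (real p - real k) * (hilbert_weight p k m * R p m)) +
    (\<Sum>p<n. \<Sum>k<p. \<Sum>m\<in>{k..<p}. 1 / (real p - real k) * (R k (Suc m) / hilbert_weight p k m))"
    by (simp only: distrib_left sum.distrib)
  also have "\<dots> \<le> (\<Sum>p<n. \<Sum>m<p. pi * R p m) + (\<Sum>q<n. \<Sum>k<q. pi * R q k)"
    unfolding sum_triple_inner[of "\<lambda>p k m. 1 / (real p - real k) * (hilbert_weight p k m * R p m)"]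
      sum_triple_outer[of "\<lambda>p k m. 1 / (real p - real k) * (R k (Suc m) / hilbert_weight p k m)"]
    by (intro add_mono sum_mono 1 2) auto
  also have "\<dots> = 2 * pi * (\<Sum>p<n. \<Sum>q<p. R p q)"
    by (simp only: sum_distrib_left[symmetric])
  also have "\<dots> \<le> 2 * pi * N" using total by (intro mult_left_mono) auto
  finally show ?thesis .
qed

section \<open>Inner products along a run of the algorithm\<close>

text \<open>For equal inputs every term of the difference bound vanishes, which gives isometry
  without computing an adjoint.\<close>

lemma oracle_gate_scalar_prod:
  assumes "u \<in> carrier_vec (qdim n w)" "v \<in> carrier_vec (qdim n w)"
  shows "conjugate (oracle_gate n w \<sigma> *\<^sub>v u) \<bullet> (oracle_gate n w \<sigma> *\<^sub>v v) = conjugate u \<bullet> v"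
  using oracle_gate_scalar_prod_diff[OF assms, of "\<lambda>_ _. 1" \<sigma> \<sigma>] by simp

lemma run_carrier:
  assumes "\<And>k. k \<le> t \<Longrightarrow> unitary_mat d (U k)" and "Or \<in> carrier_mat d d"
  shows "run d U Or t \<in> carrier_vec d"
  using assms(1)
proof (induction t)
  case 0
  then show ?case by (auto simp: unitary_mat_def)
next
  case (Suc t)
  then have "U (Suc t) \<in> carrier_mat d d" "run d U Or t \<in> carrier_vec d"
    by (auto simp: unitary_mat_def)
  then show ?case using assms(2) by simp
qed

text \<open>Both runs apply the same \<open>U (Suc t)\<close>, which cancels; only the oracle gates
  can change the inner product.\<close>

lemma run_oracle_Suc_scalar_prod:
  assumes U: "\<And>k. k \<le> Suc t \<Longrightarrow> unitary_mat (qdim n w) (U k)"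
  shows "conjugate (run (qdim n w) U (oracle_gate n w \<sigma>) (Suc t)) \<bullet>
      run (qdim n w) U (oracle_gate n w \<tau>) (Suc t) =
    conjugate (oracle_gate n w \<sigma> *\<^sub>v run (qdim n w) U (oracle_gate n w \<sigma>) t) \<bullet>
      (oracle_gate n w \<tau> *\<^sub>v run (qdim n w) U (oracle_gate n w \<tau>) t)"
  unfolding run.simps
  by (intro unitary_mat_scalar_prod[where d = "qdim n w"] U mult_mat_vec_carrier[OF oracle_gate_carrier] run_carrier
      oracle_gate_carrier) auto

lemma run_0_scalar_prod:
  assumes "unitary_mat d (U 0)" "0 < d"
  shows "conjugate (run d U O1 0) \<bullet> run d U O2 0 = 1"
  using assms by (simp add: unitary_mat_scalar_prod)

lemma run_oracle_norm:
  assumes U: "\<And>k. k \<le> t \<Longrightarrow> unitary_mat (qdim n w) (U k)" and "0 < qdim n w"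
  shows "conjugate (run (qdim n w) U (oracle_gate n w \<sigma>) t) \<bullet> run (qdim n w) U (oracle_gate n w \<sigma>) t = 1"
  using U
proof (induction t)
  case 0
  then show ?case using assms(2) by (intro run_0_scalar_prod) auto
next
  case (Suc t)
  let ?\<psi> = "run (qdim n w) U (oracle_gate n w \<sigma>)"
  have c: "?\<psi> t \<in> carrier_vec (qdim n w)"
    by (intro run_carrier oracle_gate_carrier Suc.prems) auto
  have "conjugate (?\<psi> (Suc t)) \<bullet> ?\<psi> (Suc t) =
      conjugate (oracle_gate n w \<sigma> *\<^sub>v ?\<psi> t) \<bullet> (oracle_gate n w \<sigma> *\<^sub>v ?\<psi> t)"
    by (rule run_oracle_Suc_scalar_prod) (rule Suc.prems)
  also have "\<dots> = conjugate (?\<psi> t) \<bullet> ?\<psi> t" by (rule oracle_gate_scalar_prod[OF c c])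
  also have "\<dots> = 1" using Suc by simp
  finally show ?case .
qed

subsection \<open>The progress measure\<close>

text \<open>\<open>cyc k p \<circ> \<sigma>\<close> moves the element of rank \<open>p\<close> down to rank \<open>k\<close>, and such a pair
  of inputs has weight \<open>1 / (p - k)\<close>.\<close>
definition overlap :: "nat \<Rightarrow> nat \<Rightarrow> (nat \<Rightarrow> complex mat) \<Rightarrow> nat \<Rightarrow> complex" where
  "overlap n w U t = (\<Sum>\<sigma>\<in>perms n. \<Sum>p<n. \<Sum>k<p. of_real (1 / (real p - real k)) *
     (conjugate (final_state n w U t \<sigma>) \<bullet> final_state n w U t (cyc k p \<circ> \<sigma>)))"

text \<open>Before the first query the state is independent of the input, so every inner product is
  1.\<close>

lemma overlap_0:
  assumes "unitary_mat (qdim n w) (U 0)" "n \<ge> 2"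
  shows "overlap n w U 0 = of_real (fact n * (real n * harmonic (n - 1) - real n + 1))"
proof -
  have "0 < qdim n w" using assms by (simp add: qdim_def)
  then have "overlap n w U 0 = of_real (\<Sum>\<sigma>\<in>perms n. \<Sum>p<n. \<Sum>k<p. 1 / (real p - real k))"
    using run_0_scalar_prod[where U = U, OF assms(1)] by (simp add: overlap_def final_state_def del: run.simps)
  also have "\<dots> = of_real (fact n * (real n * harmonic (n - 1) - real n + 1))"
    using assms sum_inverse_diff[of n] by (simp only: sum_constant card_perms of_nat_fact)
  finally show ?thesis .
qed

lemma overlap_final_le:
  assumes U: "\<forall>k \<le> T. unitary_mat (qdim n w) (U k)" and n: "n \<ge> 2" and \<epsilon>: "\<epsilon> < 1/2"
    and E: "povm n (qdim n w) E"
    and out: "\<forall>\<sigma> \<in> perms n. outcome_prob (E \<sigma>) (final_state n w U T \<sigma>) \<ge> 1 - \<epsilon>"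
  shows "cmod (overlap n w U T) \<le>
    2 * sqrt (\<epsilon> * (1 - \<epsilon>)) * (fact n * (real n * harmonic (n - 1) - real n + 1))"
proof -
  let ?e = "2 * sqrt (\<epsilon> * (1 - \<epsilon>))"
  have d: "0 < qdim n w" using n by (simp add: qdim_def)
  have c: "final_state n w U T \<sigma> \<in> carrier_vec (qdim n w)" for \<sigma>
    unfolding final_state_def using U by (intro run_carrier oracle_gate_carrier) auto
  have norm: "conjugate (final_state n w U T \<sigma>) \<bullet> final_state n w U T \<sigma> = 1" for \<sigma>
    unfolding final_state_def using U d by (intro run_oracle_norm) auto
  have "cmod (overlap n w U T) \<le> (\<Sum>\<sigma>\<in>perms n. \<Sum>p<n. \<Sum>k<p. ?e * (1 / (real p - real k)))"
    unfolding overlap_def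
  proof (rule sum_norm_le, rule sum_norm_le, rule sum_norm_le)
    fix \<sigma> p k assume *: "\<sigma> \<in> perms n" "p \<in> {..<n}" "k \<in> {..<p}"
    then have kp: "k < p" "p < n" by auto
    have "cmod (conjugate (final_state n w U T \<sigma>) \<bullet> final_state n w U T (cyc k p \<circ> \<sigma>)) \<le> ?e"
      using *(1) out cyc_comp_perms[OF kp *(1)] cyc_comp_neq[OF kp(1) *(1)]
      by (intro povm_overlap_le[where \<sigma> = \<sigma> and \<tau> = "cyc k p \<circ> \<sigma>", OF E _ _ _ \<epsilon>] c norm) auto
    then show "cmod (of_real (1 / (real p - real k)) *
        (conjugate (final_state n w U T \<sigma>) \<bullet> final_state n w U T (cyc k p \<circ> \<sigma>))) \<le> ?e * (1 / (real p - real k))"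
      unfolding norm_mult norm_of_real using kp by (simp add: divide_right_mono)
  qed
  also have "\<dots> = ?e * (fact n * (real n * harmonic (n - 1) - real n + 1))"
    using n sum_inverse_diff[of n]
    by (simp only: sum_distrib_left[symmetric] sum_constant card_perms of_nat_fact)
  finally show ?thesis .
qed

text \<open>The rank weights are summed over all inputs before the Schur test, so that both members
  of the pairs contribute through the same function \<open>R\<close>.\<close>

lemma overlap_step_le:
  assumes U: "\<And>k. k \<le> Suc t \<Longrightarrow> unitary_mat (qdim n w) (U k)" and n: "n \<ge> 2"
  shows "cmod (overlap n w U t - overlap n w U (Suc t)) \<le> 2 * pi * fact n"
proof -
  define \<psi> where "\<psi> \<sigma> = final_state n w U t \<sigma>" for \<sigma>
  define R where "R p q = (\<Sum>\<sigma>\<in>perms n. rank_weight n w \<sigma> (\<psi> \<sigma>) p q)" for p q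
  have d: "0 < qdim n w" using n by (simp add: qdim_def)
  have c: "\<psi> \<sigma> \<in> carrier_vec (qdim n w)" for \<sigma>
    unfolding \<psi>_def final_state_def using U by (intro run_carrier oracle_gate_carrier) auto
  have norm: "conjugate (\<psi> \<sigma>) \<bullet> \<psi> \<sigma> = 1" for \<sigma>
    unfolding \<psi>_def final_state_def using U d by (intro run_oracle_norm) auto
  have step: "conjugate (final_state n w U (Suc t) \<sigma>) \<bullet> final_state n w U (Suc t) \<tau> =
      conjugate (oracle_gate n w \<sigma> *\<^sub>v \<psi> \<sigma>) \<bullet> (oracle_gate n w \<tau> *\<^sub>v \<psi> \<tau>)" for \<sigma> \<tau>
    unfolding \<psi>_def final_state_def by (rule run_oracle_Suc_scalar_prod) (rule U)
  let ?D = "\<lambda>\<sigma> p k. conjugate (\<psi> \<sigma>) \<bullet> \<psi> (cyc k p \<circ> \<sigma>) - conjugate (oracle_gate n w \<sigma> *\<^sub>v \<psi> \<sigma>) \<bullet>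
      (oracle_gate n w (cyc k p \<circ> \<sigma>) *\<^sub>v \<psi> (cyc k p \<circ> \<sigma>))"
  let ?F = "\<lambda>\<sigma> p k m. hilbert_weight p k m * rank_weight n w \<sigma> (\<psi> \<sigma>) p m +
      rank_weight n w (cyc k p \<circ> \<sigma>) (\<psi> (cyc k p \<circ> \<sigma>)) k (Suc m) / hilbert_weight p k m"
  have diff: "overlap n w U t - overlap n w U (Suc t) =
      (\<Sum>\<sigma>\<in>perms n. \<Sum>p<n. \<Sum>k<p. of_real (1 / (real p - real k)) * ?D \<sigma> p k)"
    unfolding overlap_def step \<psi>_def[symmetric] by (simp only: sum_subtractf right_diff_distrib)
  have "cmod (overlap n w U t - overlap n w U (Suc t)) \<le>
      (\<Sum>\<sigma>\<in>perms n. \<Sum>p<n. \<Sum>k<p. 1 / (real p - real k) * (\<Sum>m\<in>{k..<p}. ?F \<sigma> p k m))"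
    unfolding diff
  proof (rule sum_norm_le, rule sum_norm_le, rule sum_norm_le)
    fix \<sigma> p k assume *: "\<sigma> \<in> perms n" "p \<in> {..<n}" "k \<in> {..<p}"
    then have kp: "k < p" "p < n" by auto
    have "cmod (?D \<sigma> p k) \<le> (\<Sum>m\<in>{k..<p}. ?F \<sigma> p k m)"
      by (rule oracle_gate_cyc_scalar_prod_diff[OF *(1) kp c c hilbert_weight_pos])
    then show "cmod (of_real (1 / (real p - real k)) * ?D \<sigma> p k) \<le>
        1 / (real p - real k) * (\<Sum>m\<in>{k..<p}. ?F \<sigma> p k m)"
      unfolding norm_mult norm_of_real using kp by (simp add: divide_right_mono)
  qed
  also have "\<dots> = (\<Sum>p<n. \<Sum>k<p. \<Sum>\<sigma>\<in>perms n. 1 / (real p - real k) * (\<Sum>m\<in>{k..<p}. ?F \<sigma> p k m))"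
    by (subst sum.swap) (intro sum.cong refl sum.swap)
  also have "\<dots> = (\<Sum>p<n. \<Sum>k<p. \<Sum>m\<in>{k..<p}. 1 / (real p - real k) *
      (hilbert_weight p k m * R p m + R k (Suc m) / hilbert_weight p k m))"
  proof (intro sum.cong refl)
    fix p k assume "p \<in> {..<n}" "k \<in> {..<p}"
    then have kp: "k < p" "p < n" by auto
    \<comment> \<open>As \<sigma> runs over all inputs, so does the shifted input.\<close>
    have R': "(\<Sum>\<sigma>\<in>perms n. rank_weight n w (cyc k p \<circ> \<sigma>) (\<psi> (cyc k p \<circ> \<sigma>)) k (Suc m)) = R k (Suc m)" for m
      unfolding R_def by (rule sum_perms_cyc[OF kp, where f = "\<lambda>\<sigma>. rank_weight n w \<sigma> (\<psi> \<sigma>) k (Suc m)"])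
    have "(\<Sum>\<sigma>\<in>perms n. 1 / (real p - real k) * (\<Sum>m\<in>{k..<p}. ?F \<sigma> p k m)) =
        1 / (real p - real k) * (\<Sum>m\<in>{k..<p}. \<Sum>\<sigma>\<in>perms n. ?F \<sigma> p k m)"
      unfolding sum_distrib_left[symmetric] by (rule arg_cong, rule sum.swap)
    also have "\<dots> = 1 / (real p - real k) * (\<Sum>m\<in>{k..<p}.
        hilbert_weight p k m * R p m + R k (Suc m) / hilbert_weight p k m)"
      by (simp only: sum.distrib sum_distrib_left[symmetric] sum_divide_distrib[symmetric] R' R_def[symmetric])
    finally show "(\<Sum>\<sigma>\<in>perms n. 1 / (real p - real k) * (\<Sum>m\<in>{k..<p}. ?F \<sigma> p k m)) =
        (\<Sum>m\<in>{k..<p}. 1 / (real p - real k) *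
          (hilbert_weight p k m * R p m + R k (Suc m) / hilbert_weight p k m))"
      unfolding sum_distrib_left .
  qed
  also have "\<dots> \<le> 2 * pi * fact n"
  proof (rule hilbert_weight_sum_le)
    show "0 \<le> R p q" for p q unfolding R_def by (intro sum_nonneg rank_weight_nonneg)
    show "R p q = R q p" for p q unfolding R_def by (intro sum.cong refl rank_weight_commute)
    \<comment> \<open>Each of the \<open>fact n\<close> unit states contributes at most 1.\<close>
    have "(\<Sum>p<n. \<Sum>q<p. R p q) = (\<Sum>\<sigma>\<in>perms n. \<Sum>p<n. \<Sum>q<p. rank_weight n w \<sigma> (\<psi> \<sigma>) p q)"
      unfolding R_def by (subst (2) sum.swap) (intro sum.cong refl sum.swap)
    also have "\<dots> \<le> (\<Sum>\<sigma>\<in>perms n. 1)"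
      using sum_rank_weight_le[OF _ c] norm by (intro sum_mono) fastforce
    finally show "(\<Sum>p<n. \<Sum>q<p. R p q) \<le> fact n" by (simp add: card_perms)
  qed
  finally show ?thesis .
qed

theorem mainTheorem1:
  fixes n w T :: nat and \<epsilon> :: real
    and U :: "nat \<Rightarrow> complex mat"
    and E :: "(nat \<Rightarrow> nat) \<Rightarrow> complex mat"
  assumes "n \<ge> 2"
    and "0 \<le> \<epsilon>" and "\<epsilon> < 1 / 2"
    and "\<forall>k \<le> T. unitary_mat (qdim n w) (U k)"
    and "povm n (qdim n w) E"
    and "\<forall>\<sigma> \<in> perms n. outcome_prob (E \<sigma>) (final_state n w U T \<sigma>) \<ge> 1 - \<epsilon>"
  shows "real T \<ge> (1 - 2 * sqrt (\<epsilon> * (1 - \<epsilon>))) / (2 * pi)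
                   * (real n * harmonic (n - 1) - real n + 1)"
proof -
  let ?L = "real n * harmonic (n - 1) - real n + 1" and ?e = "2 * sqrt (\<epsilon> * (1 - \<epsilon>))"
  \<comment> \<open>The bound for one query, accumulated over \<open>t\<close> queries by the
    triangle inequality.\<close>
  have "cmod (overlap n w U 0 - overlap n w U t) \<le> real t * (2 * pi * fact n)" if "t \<le> T" for t
    using that
  proof (induction t)
    case (Suc t)
    have "cmod (overlap n w U t - overlap n w U (Suc t)) \<le> 2 * pi * fact n"
      using assms(4) Suc.prems by (intro overlap_step_le assms(1)) auto
    moreover have "cmod (overlap n w U 0 - overlap n w U (Suc t)) \<le>
        cmod (overlap n w U 0 - overlap n w U t) + cmod (overlap n w U t - overlap n w U (Suc t))"
      using norm_triangle_ineq[of "overlap n w U 0 - overlap n w U t"] by (metis diff_add_cancel add_diff_eq)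
    ultimately show ?case using Suc by (simp add: algebra_simps)
  qed simp
  from this[of T] have "cmod (overlap n w U 0) - cmod (overlap n w U T) \<le> real T * (2 * pi * fact n)"
    using norm_triangle_ineq2 order_trans by blast
  moreover have "fact n * ?L \<le> cmod (overlap n w U 0)"
    using overlap_0[of n w U] assms(1,4) by (simp only: norm_of_real)
  moreover have "cmod (overlap n w U T) \<le> ?e * (fact n * ?L)"
    by (rule overlap_final_le[OF assms(4,1,3,5,6)])
  ultimately have "fact n * ((1 - ?e) * ?L) \<le> fact n * (real T * (2 * pi))"
    by (simp add: algebra_simps)
  then have "(1 - ?e) * ?L \<le> real T * (2 * pi)" by simp
  then show ?thesis by (simp add: field_simps)
qed

end
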